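(* Let $\mathcal{G}$ be a bipartite interaction graph with user set $\mathcal{U}$, item set $\mathcal{I}$ and edge (interaction) set $\mathcal{E}$, let $\boldsymbol{B}$ be its oriented incidence matrix, and let $\boldsymbol{\Phi}\boldsymbol{\Lambda}\boldsymbol{\Psi}^{\top}$ be the top-$k$ singular value decomposition of $\boldsymbol{B}$, where $\boldsymbol{\Psi}\in\mathbb{R}^{|\mathcal{E}|\times k}$. When $k=|\mathcal{U}|+|\mathcal{I}|$, $$s(e_{u,i})=\|\boldsymbol{\Psi}_{e_{u,i}}\|_2^2\qquad\text{for all } e_{u,i}\in\mathcal{E},$$ where $s(e_{u,i})$ is the spanning centrality of $e_{u,i}$ in $\mathcal{G}$ and $\boldsymbol{\Psi}_{e_{u,i}}$ is the row of $\boldsymbol{\Psi}$ indexed by $e_{u,i}$.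
   Context: $\mathcal{G}$ is a bipartite graph whose node set is the disjoint union of a finite set $\mathcal{U}$ of users and a finite set $\mathcal{I}$ of items; each edge $e_{u,i}\in\mathcal{E}$ joins a user $u\in\mathcal{U}$ to an item $i\in\mathcal{I}$. The oriented incidence matrix $\boldsymbol{B}\in\mathbb{R}^{(|\mathcal{U}|+|\mathcal{I}|)\times|\mathcal{E}|}$ has, for each $e_{u,i}\in\mathcal{E}$ with user $u\in\mathcal{U}$ and item $i\in\mathcal{I}$, $\boldsymbol{B}_{u,e_{u,i}}=1$, $\boldsymbol{B}_{i,e_{u,i}}=-1$, and $\boldsymbol{B}_{x,e_{u,i}}=0$ if $x\notin\{u,i\}$. In the top-$k$ singular value decomposition $\boldsymbol{\Phi}\boldsymbol{\Lambda}\boldsymbol{\Psi}^{\top}$ of $\boldsymbol{B}$, $\boldsymbol{\Lambda}$ is the diagonal matrix of the top $k$ singular values, and $\boldsymbol{\Phi}$, $\boldsymbol{\Psi}$ contain the corresponding left and right singular vectors as columns. The spanning centrality of an edge $e_{u,i}$ is $s(e_{u,i})=|\tau(\mathcal{G})_{e_{u,i}}|/|\tau(\mathcal{G})|$, where $\tau(\mathcal{G})$ is the set of spanning trees of $\mathcal{G}$ and $\tau(\mathcal{G})_{e_{u,i}}$ is the set of those spanning trees that contain $e_{u,i}$.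
   Formalization: The graph is assumed to have a spanning tree (otherwise s is 0/0), and columns of Ψ for singular value 0 are taken to be zero; with unit right singular vectors there the identity fails (for a 4-cycle all rows of Ψ have norm 1, but s = 3/4). *)

theory Defs
  imports "Jordan_Normal_Form.Matrix" "HOL-Analysis.L2_Norm"
begin

text \<open>
  A bipartite graph is given by a user set \<open>U\<close>, an item set \<open>I\<close> and an edge set
  \<open>E \<subseteq> U \<times> I\<close>; the edge joining \<open>u\<close> and \<open>i\<close> is the pair \<open>(u, i)\<close>.  Nodes live in a sum
  type, so users and items are automatically disjoint.
\<close>

definition nodes :: "'u set \<Rightarrow> 'i set \<Rightarrow> ('u + 'i) set" where
  "nodes U I = Inl ` U \<union> Inr ` I"

definition adj :: "('u \<times> 'i) set \<Rightarrow> ('u + 'i) rel" where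
  "adj T = {(Inl u, Inr i) | u i. (u, i) \<in> T} \<union> {(Inr i, Inl u) | u i. (u, i) \<in> T}"

text \<open>
  The graph is undirected, so a cycle is a cyclic sequence of at least three distinct nodes
  with consecutive ones adjacent.  (The trees of the session Graph_Theory cannot be used:
  their cycles are directed, so no graph with all edges oriented from users to items has one.)
\<close>

definition is_cycle :: "('u \<times> 'i) set \<Rightarrow> ('u + 'i) list \<Rightarrow> bool" where
  "is_cycle T xs \<longleftrightarrow> 3 \<le> length xs \<and> distinct xs \<and>
     (\<forall>j < length xs. (xs ! j, xs ! (Suc j mod length xs)) \<in> adj T)"

definition connected_on :: "'u set \<Rightarrow> 'i set \<Rightarrow> ('u \<times> 'i) set \<Rightarrow> bool" where
  "connected_on U I T \<longleftrightarrow> nodes U I \<noteq> {} \<and>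
     (\<forall>x \<in> nodes U I. \<forall>y \<in> nodes U I. (x, y) \<in> (adj T)\<^sup>*)"

text \<open>A spanning tree has the full node set, so it is identified with its edge set.\<close>

definition spanning_trees :: "'u set \<Rightarrow> 'i set \<Rightarrow> ('u \<times> 'i) set \<Rightarrow> ('u \<times> 'i) set set" where
  "spanning_trees U I E = {T. T \<subseteq> E \<and> connected_on U I T \<and> (\<nexists>xs. is_cycle T xs)}"

definition spanning_centrality ::
    "'u set \<Rightarrow> 'i set \<Rightarrow> ('u \<times> 'i) set \<Rightarrow> 'u \<times> 'i \<Rightarrow> real" where
  "spanning_centrality U I E e =
     real (card {T \<in> spanning_trees U I E. e \<in> T}) / real (card (spanning_trees U I E))"

text \<open>
  Library matrices are indexed by numbers; the lists \<open>vs\<close> and \<open>es\<close> enumerate the nodes (rows)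
  and the edges (columns).
\<close>

definition incidence_entry :: "'u + 'i \<Rightarrow> 'u \<times> 'i \<Rightarrow> real" where
  "incidence_entry x e =
     (if x = Inl (fst e) then 1 else if x = Inr (snd e) then - 1 else 0)"

definition incidence_matrix :: "('u + 'i) list \<Rightarrow> ('u \<times> 'i) list \<Rightarrow> real mat" where
  "incidence_matrix vs es =
     mat (length vs) (length es) (\<lambda>(p, q). incidence_entry (vs ! p) (es ! q))"

text \<open>
  The SVD restricted to the positive singular values; \<open>r\<close> is then the rank of \<open>B\<close>.
\<close>

definition compact_svd ::
    "real mat \<Rightarrow> nat \<Rightarrow> real mat \<Rightarrow> real mat \<Rightarrow> real mat \<Rightarrow> bool" where
  "compact_svd B r \<Phi> \<Lambda> \<Psi> \<longleftrightarrow>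
     \<Phi> \<in> carrier_mat (dim_row B) r \<and> \<Lambda> \<in> carrier_mat r r \<and> \<Psi> \<in> carrier_mat (dim_col B) r \<and>
     diagonal_mat \<Lambda> \<and>
     (\<forall>j < r. 0 < \<Lambda> $$ (j, j)) \<and>
     (\<forall>i j. i \<le> j \<longrightarrow> j < r \<longrightarrow> \<Lambda> $$ (j, j) \<le> \<Lambda> $$ (i, i)) \<and>
     transpose_mat \<Phi> * \<Phi> = 1\<^sub>m r \<and>
     transpose_mat \<Psi> * \<Psi> = 1\<^sub>m r \<and>
     B = \<Phi> * \<Lambda> * transpose_mat \<Psi>"

text \<open>
  The top-\<open>k\<close> SVD takes the first \<open>k\<close> singular triples.  For \<open>k\<close> larger than the rank \<open>r\<close> the
  missing singular values are \<open>0\<close> and the corresponding columns of \<open>\<Psi>\<close> are \<open>0\<close>, i.e. only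
  positive singular values contribute right singular vectors.  A kernel vector of \<open>B\<close> is not
  admitted there: for a 4-cycle and \<open>k = 4\<close> it would make \<open>\<Psi>\<close> an orthogonal matrix with all
  rows of norm \<open>1\<close>, and for a tree with \<open>k\<close> nodes there are only \<open>k - 1\<close> edges, hence no \<open>k\<close>
  orthonormal columns.  The surplus columns of \<open>\<Phi>\<close> only have to satisfy the singular vector
  equation for the singular value \<open>0\<close>; this admits both zero columns and an
  orthonormal completion.
\<close>

definition top_k_svd ::
    "real mat \<Rightarrow> nat \<Rightarrow> real mat \<Rightarrow> real mat \<Rightarrow> real mat \<Rightarrow> bool" where
  "top_k_svd B k \<Phi> \<Lambda> \<Psi> \<longleftrightarrow>
     \<Phi> \<in> carrier_mat (dim_row B) k \<and> \<Lambda> \<in> carrier_mat k k \<and> \<Psi> \<in> carrier_mat (dim_col B) k \<and>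
     (\<exists>r \<Phi>' \<Lambda>' \<Psi>'. compact_svd B r \<Phi>' \<Lambda>' \<Psi>' \<and>
        \<Lambda> = mat k k (\<lambda>(i, j). if i = j \<and> j < r then \<Lambda>' $$ (j, j) else 0) \<and>
        (\<forall>j < k.
           if j < r then col \<Phi> j = col \<Phi>' j \<and> col \<Psi> j = col \<Psi>' j
           else transpose_mat B *\<^sub>v col \<Phi> j = 0\<^sub>v (dim_col B) \<and> col \<Psi> j = 0\<^sub>v (dim_col B)))"

definition l2_norm_vec :: "real vec \<Rightarrow> real" where
  "l2_norm_vec v = L2_set (\<lambda>j. v $ j) {..<dim_vec v}"

end

theory Submission
  imports Defs
begin

text \<open>
  Kirchhoff's averaging argument.  For a spanning tree \<open>T\<close> the columns of \<open>B\<close> indexed by \<open>T\<close>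
  form a basis of the column space; let \<open>A\<close> be the average over all \<open>T\<close> of the matrices that
  express every column in the basis \<open>T\<close>.  Then \<open>B A = B\<close>, \<open>A\<close> annihilates the kernel of \<open>B\<close>,
  and the diagonal entries of \<open>A\<close> are the spanning centralities.  Exchanging an edge \<open>f \<in> T\<close>
  for \<open>e \<notin> T\<close> replaces a nonzero coefficient \<open>c\<close> by \<open>1 / c\<close>; coefficients are integers because
  they come from paths in \<open>T\<close>, so \<open>1 / c = c\<close> and \<open>A\<close> is symmetric.  The matrix
  \<open>\<Psi> \<Psi>\<^sup>T\<close> has the same three properties, and these determine a matrix uniquely.
\<close>

section \<open>Orthogonal projectors onto a row space and their uniqueness\<close>

text \<open>With \<open>b\<close> read as a matrix \<open>B\<close> and finite \<open>E\<close>, the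
  conditions \<open>P\<close> symmetric, \<open>B P = B\<close> and \<open>ker B\<close> contained
  in \<open>ker P\<close> describe the orthogonal projector onto the row space of
  \<open>B\<close>.\<close>

definition row_space_projector ::
    "'v set \<Rightarrow> 'e set \<Rightarrow> ('v \<Rightarrow> 'e \<Rightarrow> real) \<Rightarrow> ('e \<Rightarrow> 'e \<Rightarrow> real) \<Rightarrow> bool" where
  "row_space_projector V E b P \<longleftrightarrow>
     (\<forall>e\<in>E. \<forall>f\<in>E. P e f = P f e) \<and>
     (\<forall>v\<in>V. \<forall>e\<in>E. (\<Sum>f\<in>E. b v f * P f e) = b v e) \<and>
     (\<forall>c. (\<forall>v\<in>V. (\<Sum>e\<in>E. b v e * c e) = 0) \<longrightarrow> (\<forall>f\<in>E. (\<Sum>e\<in>E. P f e * c e) = 0))"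

text \<open>This is \<open>P A = P\<close>: since \<open>B A = B\<close>, each column
  \<open>c\<close> of \<open>A - 1\<close> lies in the kernel of \<open>B\<close>, and
  \<open>P\<close> annihilates that kernel.\<close>

lemma row_space_projector_absorb:
  assumes "finite E" "row_space_projector V E b A" "row_space_projector V E b P"
    and "e \<in> E" "f \<in> E"
  shows "(\<Sum>g\<in>E. P f g * A g e) = P f e"
proof -
  define c where "c g = A g e - of_bool (g = e)" for g
  have "(\<Sum>g\<in>E. b v g * c g) = 0" if "v \<in> V" for v
  proof -
    have "(\<Sum>g\<in>E. b v g * c g) = (\<Sum>g\<in>E. b v g * A g e) - (\<Sum>g\<in>E. b v g * of_bool (g = e))"
      by (simp add: c_def right_diff_distrib sum_subtractf)
    then show ?thesis
      using assms that by (simp add: row_space_projector_def)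
  qed
  then have "(\<Sum>g\<in>E. P f g * c g) = 0"
    using assms(3,5) unfolding row_space_projector_def by blast
  moreover have "(\<Sum>g\<in>E. P f g * c g) = (\<Sum>g\<in>E. P f g * A g e) - P f e"
    using assms by (simp add: c_def right_diff_distrib sum_subtractf)
  ultimately show ?thesis by simp
qed

text \<open>Absorption in both orders gives \<open>P A = P\<close> and \<open>A P = A\<close>.
  Transposing the first by symmetry gives \<open>A P = P\<close>, hence
  \<open>A = P\<close>.\<close>

lemma row_space_projector_unique:
  assumes "finite E" "row_space_projector V E b A" "row_space_projector V E b P"
    and "e \<in> E" "f \<in> E"
  shows "A f e = P f e"
proof -
  have sA: "A x y = A y x" and sP: "P x y = P y x" if "x \<in> E" "y \<in> E" for x y
    using assms that by (auto simp: row_space_projector_def)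
  have "P f e = (\<Sum>g\<in>E. P f g * A g e)"
    using row_space_projector_absorb[OF assms] by simp
  also have "\<dots> = (\<Sum>g\<in>E. A e g * P g f)"
    using assms sA sP by (intro sum.cong) (auto simp: mult.commute)
  also have "\<dots> = A f e"
    using row_space_projector_absorb[OF assms(1,3,2,5,4)] sA assms by simp
  finally show ?thesis by simp
qed

lemma row_space_projector_cong:
  assumes "\<And>v e. v \<in> V \<Longrightarrow> e \<in> E \<Longrightarrow> b v e = b' v e"
  shows "row_space_projector V E b P \<longleftrightarrow> row_space_projector V E b' P"
  by (simp add: row_space_projector_def assms)

text \<open>Serves to pass from nodes and edges to the row and column numbers of library
  matrices.\<close>

lemma row_space_projector_reindex:
  assumes P: "row_space_projector V E b P" and g: "bij_betw g V' V" and h: "bij_betw h E' E"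
  shows "row_space_projector V' E' (\<lambda>p q. b (g p) (h q)) (\<lambda>p q. P (h p) (h q))"
proof -
  have gV: "g v \<in> V" if "v \<in> V'" for v using g that by (auto simp: bij_betw_def)
  have hE: "h e \<in> E" if "e \<in> E'" for e using h that by (auto simp: bij_betw_def)
  have Vg: "\<exists>p\<in>V'. v = g p" if "v \<in> V" for v using g that by (auto simp: bij_betw_def)
  have "(\<Sum>f\<in>E'. b (g v) (h f) * P (h f) (h e)) = b (g v) (h e)" if "v \<in> V'" "e \<in> E'" for v e
    using sum.reindex_bij_betw[OF h, of "\<lambda>f. b (g v) f * P f (h e)"] P gV hE that
    by (simp add: row_space_projector_def)
  moreover have "(\<Sum>e\<in>E'. P (h f) (h e) * c e) = 0"
    if c: "\<forall>v\<in>V'. (\<Sum>e\<in>E'. b (g v) (h e) * c e) = 0" and f: "f \<in> E'" for c f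
  proof -
    \<comment> \<open>The kernel vector \<open>c\<close> is carried to \<open>E\<close> along the
      inverse of \<open>h\<close>; only the values of \<open>d\<close> on \<open>E\<close>
      matter.\<close>
    define d where "d e = c (the_inv_into E' h e)" for e
    have dh: "d (h e) = c e" if "e \<in> E'" for e
      using h that by (simp add: d_def bij_betw_def the_inv_into_f_f)
    have "(\<Sum>e\<in>E. b v e * d e) = 0" if "v \<in> V" for v
    proof -
      obtain p where p: "p \<in> V'" "v = g p" using Vg \<open>v \<in> V\<close> by blast
      show ?thesis
        using sum.reindex_bij_betw[OF h, of "\<lambda>e. b v e * d e"] c p by (simp add: dh)
    qed
    then have "(\<Sum>e\<in>E. P (h f) e * d e) = 0"
      using P hE[OF f] unfolding row_space_projector_def by blast
    then show ?thesis
      using sum.reindex_bij_betw[OF h, of "\<lambda>e. P (h f) e * d e"] by (simp add: dh)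
  qed
  ultimately show ?thesis
    using P hE by (simp add: row_space_projector_def)
qed

section \<open>Bases among the columns of a finite family, coordinates and exchange\<close>

locale vector_family =
  fixes V :: "'v set" and E :: "'e set" and b :: "'v \<Rightarrow> 'e \<Rightarrow> real"
  assumes finite_E: "finite E"
begin

text \<open>Coefficient vectors are total functions vanishing off \<open>T\<close>, so uniqueness of
  coordinates becomes equality of functions, as in \<open>coord_eqI\<close>.\<close>

definition supported :: "'e set \<Rightarrow> ('e \<Rightarrow> real) \<Rightarrow> bool" where
  "supported T x \<longleftrightarrow> (\<forall>e. e \<notin> T \<longrightarrow> x e = 0)"

definition comb :: "('e \<Rightarrow> real) \<Rightarrow> 'v \<Rightarrow> real" where
  "comb x v = (\<Sum>e\<in>E. b v e * x e)"

definition indep :: "'e set \<Rightarrow> bool" where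
  "indep T \<longleftrightarrow> (\<forall>x. supported T x \<longrightarrow> (\<forall>v\<in>V. comb x v = 0) \<longrightarrow> (\<forall>e. x e = 0))"

definition spans :: "'e set \<Rightarrow> bool" where
  "spans T \<longleftrightarrow> (\<forall>e\<in>E. \<exists>x. supported T x \<and> (\<forall>v\<in>V. comb x v = b v e))"

definition basis :: "'e set \<Rightarrow> bool" where
  "basis T \<longleftrightarrow> T \<subseteq> E \<and> indep T \<and> spans T"

definition coord :: "'e set \<Rightarrow> 'e \<Rightarrow> 'e \<Rightarrow> real" where
  "coord T e = (SOME x. supported T x \<and> (\<forall>v\<in>V. comb x v = b v e))"

lemma comb_add: "comb (\<lambda>e. x e + y e) v = comb x v + comb y v"
  by (simp add: comb_def distrib_left sum.distrib)

lemma comb_diff: "comb (\<lambda>e. x e - y e) v = comb x v - comb y v"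
  by (simp add: comb_def right_diff_distrib sum_subtractf)

lemma comb_scale: "comb (\<lambda>e. t * x e) v = t * comb x v"
  by (simp add: comb_def sum_distrib_left mult_ac)

lemma comb_single: "e \<in> E \<Longrightarrow> comb (\<lambda>g. of_bool (g = e)) v = b v e"
  using finite_E by (simp add: comb_def)

lemmas comb_simps = comb_add comb_diff comb_scale comb_single

lemma coord:
  assumes "basis T" "e \<in> E"
  shows supported_coord: "supported T (coord T e)"
    and comb_coord: "v \<in> V \<Longrightarrow> comb (coord T e) v = b v e"
proof -
  have "\<exists>x. supported T x \<and> (\<forall>v\<in>V. comb x v = b v e)"
    using assms by (simp add: basis_def spans_def)
  from someI_ex[OF this] show "supported T (coord T e)"
    and "v \<in> V \<Longrightarrow> comb (coord T e) v = b v e"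
    by (simp_all add: coord_def)
qed

lemma coord_eqI:
  assumes "basis T" "e \<in> E" "supported T x" "\<And>v. v \<in> V \<Longrightarrow> comb x v = b v e"
  shows "coord T e = x"
proof -
  have "supported T (\<lambda>g. coord T e g - x g)"
    using supported_coord[OF assms(1,2)] assms(3) by (simp add: supported_def)
  moreover have "comb (\<lambda>g. coord T e g - x g) v = 0" if "v \<in> V" for v
    using assms that by (simp add: comb_simps comb_coord)
  ultimately have "\<forall>g. coord T e g - x g = 0"
    using assms(1) unfolding basis_def indep_def by blast
  then show ?thesis by auto
qed

lemma coord_notin: "basis T \<Longrightarrow> e \<in> E \<Longrightarrow> f \<notin> T \<Longrightarrow> coord T e f = 0"
  using supported_coord by (auto simp: supported_def)

lemma coord_member:
  assumes "basis T" "e \<in> T"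
  shows "coord T e = (\<lambda>g. of_bool (g = e))"
proof (rule coord_eqI)
  show "e \<in> E" using assms by (auto simp: basis_def)
  then show "comb (\<lambda>g. of_bool (g = e)) v = b v e" for v
    by (rule comb_single)
qed (use assms in \<open>auto simp: supported_def\<close>)

text \<open>Weighting the coordinate vectors by \<open>c\<close> gives a vector supported on
  \<open>T\<close> with the same combination as \<open>c\<close>, namely zero; independence of
  \<open>T\<close> makes it vanish.\<close>

lemma coord_relation:
  assumes T: "basis T" and c: "\<And>v. v \<in> V \<Longrightarrow> comb c v = 0"
  shows "(\<Sum>e\<in>E. c e * coord T e f) = 0"
proof -
  define x where "x g = (\<Sum>e\<in>E. c e * coord T e g)" for g
  have "supported T x"
    using coord_notin[OF T] by (simp add: supported_def x_def)
  moreover have "comb x v = 0" if v: "v \<in> V" for v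
  proof -
    have "comb x v = (\<Sum>e\<in>E. \<Sum>g\<in>E. b v g * (c e * coord T e g))"
      unfolding comb_def x_def by (subst sum.swap) (simp add: sum_distrib_left)
    also have "\<dots> = (\<Sum>e\<in>E. c e * comb (coord T e) v)"
      by (simp add: comb_def sum_distrib_left mult_ac)
    also have "\<dots> = (\<Sum>e\<in>E. b v e * c e)"
      using comb_coord[OF T _ v] by (simp add: mult.commute)
    finally show ?thesis using c[OF v] by (simp add: comb_def)
  qed
  ultimately show ?thesis
    using T unfolding basis_def indep_def x_def by blast
qed

text \<open>Steinitz exchange: a nonzero coefficient at \<open>f\<close> allows the expansion of
  column \<open>e\<close> in \<open>T\<close> to be solved for column \<open>f\<close>.\<close>

lemma exchange:
  assumes T: "basis T" and e: "e \<in> E" "e \<notin> T" and nz: "coord T e f \<noteq> 0"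
  shows basis_exchange: "basis (insert e (T - {f}))"
    and coord_exchange: "coord (insert e (T - {f})) f e = 1 / coord T e f"
proof -
  let ?T = "insert e (T - {f})"
  have fT: "f \<in> T" using coord_notin[OF T e(1)] nz by blast
  have fE: "f \<in> E" using fT T by (auto simp: basis_def)
  have ef: "e \<noteq> f" using e fT by blast
  have "x g = 0" if x: "supported ?T x" and rel: "\<forall>v\<in>V. comb x v = 0" for x g
  proof -
    \<comment> \<open>\<open>y\<close> replaces column \<open>e\<close> in the relation
      \<open>x\<close> by its expansion in \<open>T\<close>, so the coefficient at \<open>e\<close>
      cancels. Its coefficient at \<open>f\<close> is then \<open>x e * coord T e f\<close>, which
      forces \<open>x e = 0\<close>.\<close>
    define y where "y = (\<lambda>g. x g + x e * (coord T e g - of_bool (g = e)))"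
    have "supported T y"
      using x coord_notin[OF T e(1)] e(2) by (auto simp: supported_def y_def)
    moreover have "comb y v = 0" if "v \<in> V" for v
      using rel that e by (simp add: y_def comb_simps comb_coord[OF T e(1)])
    ultimately have y0: "\<And>g. y g = 0"
      using T unfolding basis_def indep_def by blast
    have "x f = 0" using x ef by (simp add: supported_def)
    then have "x e = 0" using y0[of f] ef nz by (simp add: y_def)
    then show ?thesis using y0[of g] by (simp add: y_def)
  qed
  then have ind: "indep ?T" by (auto simp: indep_def)
  \<comment> \<open>\<open>t h\<close> is the multiple of the relation between column
    \<open>e\<close> and its expansion that removes \<open>f\<close> from the coordinates of
    \<open>h\<close>; for \<open>h = f\<close> it equals \<open>1 / coord T e f\<close>.\<close>
  define t where "t h = coord T h f / coord T e f" for h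
  define z where "z h = (\<lambda>g. coord T h g + t h * (of_bool (g = e) - coord T e g))" for h
  have z: "supported ?T (z h)" "v \<in> V \<Longrightarrow> comb (z h) v = b v h" if "h \<in> E" for h v
  proof -
    show "supported ?T (z h)"
      using that e nz ef coord_notin[OF T] by (auto simp: z_def t_def supported_def)
    show "comb (z h) v = b v h" if "v \<in> V"
      using that \<open>h \<in> E\<close> e T by (simp add: z_def comb_simps comb_coord)
  qed
  then have "spans ?T" unfolding spans_def by blast
  then show bT: "basis ?T"
    using ind T e by (auto simp: basis_def)
  have "coord ?T f = z f"
    by (rule coord_eqI[OF bT fE]) (use z fE in auto)
  then show "coord ?T f e = 1 / coord T e f"
    using coord_notin[OF T] coord_member[OF T fT] e ef by (simp add: z_def t_def)
qed

end

section \<open>Averaging integral coordinates over all bases\<close>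

locale integral_vector_family = vector_family +
  assumes coord_Ints: "basis T \<Longrightarrow> e \<in> E \<Longrightarrow> coord T e f \<in> \<int>"
    and ex_basis: "\<exists>T. basis T"
begin

lemma finite_bases: "finite {T. basis T}"
  by (rule finite_subset[of _ "Pow E"]) (auto simp: basis_def finite_E)

text \<open>The coefficient and its reciprocal are both integers, so it is \<open>1\<close> or
  \<open>-1\<close> and equals its own reciprocal.\<close>

lemma coord_exchange_eq:
  assumes T: "basis T" and e: "e \<in> E" "e \<notin> T" and nz: "coord T e f \<noteq> 0"
  shows "coord (insert e (T - {f})) f e = coord T e f"
proof -
  have "f \<in> E" using coord_notin[OF T e(1), of f] nz T by (auto simp: basis_def)
  then obtain m n where mn: "coord T e f = of_int m" "1 / coord T e f = of_int n"
    using coord_Ints[OF T e(1), of f] coord_Ints[OF basis_exchange[OF assms], of f e]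
    unfolding coord_exchange[OF assms] by (auto elim!: Ints_cases)
  then have "real_of_int (m * n) = 1" using nz by (auto simp: field_simps)
  then have "m * n = 1" by linarith
  then have "m = n" by (auto simp: zmult_eq_1_iff)
  then show ?thesis using mn coord_exchange[OF assms] by simp
qed

text \<open>For distinct \<open>e\<close> and \<open>f\<close>, a nonzero term on the left has
  \<open>f\<close> in \<open>T\<close> and \<open>e\<close> outside. Exchanging \<open>f\<close> for
  \<open>e\<close> preserves the coefficient and maps these bases bijectively to those with nonzero
  terms on the right; the inverse is the reverse exchange.\<close>

lemma sum_coord_commute:
  assumes e: "e \<in> E" and f: "f \<in> E"
  shows "(\<Sum>T | basis T. coord T e f) = (\<Sum>T | basis T. coord T f e)"
proof (cases "e = f")
  case False
  have nz: "b \<in> T \<and> a \<notin> T" if "basis T" "a \<in> E" "coord T a b \<noteq> 0" "a \<noteq> b" for T a b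
    using coord_notin[of T a b] coord_member[of T a] that by (auto simp: of_bool_def)
  have restrict: "(\<Sum>T | basis T. coord T a b) = (\<Sum>T | basis T \<and> coord T a b \<noteq> 0. coord T a b)"
    for a b
    by (rule sum.mono_neutral_right) (auto simp: finite_bases)
  have swap: "basis (insert a (T - {b})) \<and> coord (insert a (T - {b})) b a = coord T a b \<and>
      insert b (insert a (T - {b}) - {a}) = T"
    if "basis T" "a \<in> E" "coord T a b \<noteq> 0" "a \<noteq> b" for T a b
    using nz[OF that] basis_exchange[of T a b] coord_exchange_eq[of T a b] that by auto
  have "(\<Sum>T | basis T \<and> coord T e f \<noteq> 0. coord T e f)
      = (\<Sum>T | basis T \<and> coord T f e \<noteq> 0. coord T f e)"
    by (rule sum.reindex_bij_witness[where i = "\<lambda>T. insert f (T - {e})"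
          and j = "\<lambda>T. insert e (T - {f})"])
      (use swap[of _ e f] swap[of _ f e] e f False in auto)
  then show ?thesis by (simp only: restrict)
qed simp

text \<open>Row index first: column \<open>e\<close> of this matrix is the mean coordinate vector of
  \<open>e\<close>.\<close>

definition avg_coord :: "'b \<Rightarrow> 'b \<Rightarrow> real" where
  "avg_coord f e = (\<Sum>T | basis T. coord T e f) / card {T. basis T}"

lemma card_bases_pos: "card {T. basis T} > 0"
  using ex_basis finite_bases by (auto simp: card_gt_0_iff)

text \<open>Only symmetry needs the averaging; the other two conditions hold for each basis
  separately and pass to the mean.\<close>

lemma row_space_projector_avg_coord: "row_space_projector V E b avg_coord"
  unfolding row_space_projector_def
proof (intro conjI ballI allI impI)
  show "avg_coord e f = avg_coord f e" if "e \<in> E" "f \<in> E" for e f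
    using sum_coord_commute that by (simp add: avg_coord_def)
  show "(\<Sum>f\<in>E. b v f * avg_coord f e) = b v e" if "v \<in> V" "e \<in> E" for v e
  proof -
    have "(\<Sum>f\<in>E. b v f * avg_coord f e)
        = (\<Sum>T | basis T. comb (coord T e) v) / card {T. basis T}"
      unfolding avg_coord_def comb_def
      by (subst sum.swap) (simp add: sum_distrib_left sum_divide_distrib)
    also have "\<dots> = b v e"
      using that card_bases_pos by (simp add: comb_coord)
    finally show ?thesis .
  qed
  show "(\<Sum>e\<in>E. avg_coord f e * c e) = 0"
    if "\<forall>v\<in>V. (\<Sum>e\<in>E. b v e * c e) = 0" for c f
  proof -
    have "(\<Sum>e\<in>E. avg_coord f e * c e)
        = (\<Sum>T | basis T. \<Sum>e\<in>E. c e * coord T e f) / card {T. basis T}"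
      unfolding avg_coord_def
      by (subst sum.swap) (simp add: sum_distrib_left sum_divide_distrib mult_ac)
    also have "\<dots> = 0"
      using that by (simp add: coord_relation comb_def)
    finally show ?thesis .
  qed
qed

lemma avg_coord_diag:
  assumes "e \<in> E"
  shows "avg_coord e e = card {T. basis T \<and> e \<in> T} / card {T. basis T}"
proof -
  have "coord T e e = of_bool (e \<in> T)" if "basis T" for T
    using assms that coord_notin[of T e e] coord_member[of T e] by auto
  then have "(\<Sum>T | basis T. coord T e e) = (\<Sum>T | basis T. of_bool (e \<in> T))"
    by (intro sum.cong) auto
  also have "\<dots> = card {T. basis T \<and> e \<in> T}"
    using finite_bases by (simp add: sum_of_bool_eq Int_def)
  finally show ?thesis by (simp add: avg_coord_def)
qed

end

section \<open>Adjacency and cycles in undirected bipartite graphs\<close>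

lemma incidence_entry_pair:
  "incidence_entry v (u, i) = of_bool (v = Inl u) - of_bool (v = Inr i)"
  by (simp add: incidence_entry_def)

lemma adj_simps [simp]:
  "(Inl u, Inr i) \<in> adj T \<longleftrightarrow> (u, i) \<in> T"
  "(Inr i, Inl u) \<in> adj T \<longleftrightarrow> (u, i) \<in> T"
  "(Inl u, Inl u') \<notin> adj T"
  "(Inr i, Inr i') \<notin> adj T"
  by (auto simp: adj_def)

lemma adj_sym: "(x, y) \<in> adj T \<Longrightarrow> (y, x) \<in> adj T"
  by (auto simp: adj_def)

lemma adj_irrefl: "(x, x) \<notin> adj T"
  by (auto simp: adj_def)

lemma adj_mono: "S \<subseteq> T \<Longrightarrow> adj S \<subseteq> adj T"
  by (auto simp: adj_def)

lemma adjE: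
  assumes "(x, y) \<in> adj T"
  obtains u i where "(u, i) \<in> T" "x = Inl u" "y = Inr i"
    | u i where "(u, i) \<in> T" "x = Inr i" "y = Inl u"
  using assms by (auto simp: adj_def)

lemma is_cycle_mono: "is_cycle S xs \<Longrightarrow> S \<subseteq> T \<Longrightarrow> is_cycle T xs"
  using adj_mono unfolding is_cycle_def by blast

text \<open>The long way round the cycle, from its second node back to its first, joins the ends of
  the first edge without using that edge.\<close>

lemma cycle_edge_avoidable:
  assumes "is_cycle T xs"
  obtains u i where "(u, i) \<in> T" "(Inl u, Inr i) \<in> (adj (T - {(u, i)}))\<^sup>*"
proof -
  let ?n = "length xs"
  have n: "?n \<ge> 3" and d: "distinct xs"
    and step: "\<And>j. j < ?n \<Longrightarrow> (xs ! j, xs ! (Suc j mod ?n)) \<in> adj T"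
    using assms by (auto simp: is_cycle_def)
  have nonempty: "xs \<noteq> []" using n by auto
  have e01: "(xs ! 0, xs ! 1) \<in> adj T" using step[of 0] n nonempty by simp
  obtain e where e: "e \<in> T" "{xs ! 0, xs ! 1} = {Inl (fst e), Inr (snd e)}"
    using e01 by (cases rule: adjE) (metis fst_conv snd_conv, metis fst_conv snd_conv insert_commute)
  have nth: "xs ! i = xs ! j \<longleftrightarrow> i = j" if "i < ?n" "j < ?n" for i j
    using d that by (simp add: nth_eq_iff_index_eq)
  have step': "(xs ! j, xs ! (Suc j mod ?n)) \<in> adj (T - {e})" if j: "1 \<le> j" "j < ?n" for j
  proof -
    \<comment> \<open>By distinctness the first edge could recur only as step \<open>j = 1\<close>
      with successor \<open>0\<close>; length at least three makes that successor
      \<open>2\<close>.\<close>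
    have ne: "{xs ! j, xs ! (Suc j mod ?n)} \<noteq> {xs ! 0, xs ! 1}"
    proof
      assume eq: "{xs ! j, xs ! (Suc j mod ?n)} = {xs ! 0, xs ! 1}"
      have "Suc j mod ?n < ?n" using n by (intro mod_less_divisor) linarith
      moreover have "xs ! j \<noteq> xs ! 0" using nth[of j 0] j by linarith
      ultimately have "xs ! j = xs ! 1" "xs ! (Suc j mod ?n) = xs ! 0" "Suc j mod ?n < ?n"
        using eq unfolding doubleton_eq_iff by blast+
      moreover have "0 < ?n" "1 < ?n" using n by linarith+
      ultimately have "j = 1" and "Suc j mod ?n = 0"
        using nth j(2) by blast+
      moreover have "Suc 1 mod ?n = Suc 1" using n by (intro mod_less) linarith
      ultimately show False by simp
    qed
    from step[OF j(2)] show ?thesis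
    proof (cases rule: adjE)
      case (1 u i)
      then have "(u, i) \<noteq> e" using ne e(2) by (metis fst_conv snd_conv)
      then show ?thesis using 1 by simp
    next
      case (2 u i)
      then have "(u, i) \<noteq> e" using ne e(2) by (metis fst_conv insert_commute snd_conv)
      then show ?thesis using 2 by simp
    qed
  qed
  have walk: "(xs ! 1, xs ! j) \<in> (adj (T - {e}))\<^sup>*" if "1 \<le> j" "j < ?n" for j
    using that
  proof (induction j rule: nat_induct_at_least)
    case (Suc j)
    then show ?case using step'[of j] by (auto intro: rtrancl_into_rtrancl)
  qed simp
  have "(xs ! (?n - 1), xs ! 0) \<in> adj (T - {e})"
    using step'[of "?n - 1"] n nonempty by simp
  moreover have "(xs ! 1, xs ! (?n - 1)) \<in> (adj (T - {e}))\<^sup>*"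
    by (rule walk) (use n in linarith)+
  ultimately have "(xs ! 1, xs ! 0) \<in> (adj (T - {e}))\<^sup>*"
    by (rule rtrancl_into_rtrancl[rotated])
  moreover have "sym ((adj (T - {e}))\<^sup>*)"
    by (rule sym_rtrancl, rule symI, rule adj_sym)
  ultimately have "(Inl (fst e), Inr (snd e)) \<in> (adj (T - {e}))\<^sup>*"
    using e(2) unfolding doubleton_eq_iff by (metis symD)
  then show thesis using that[of "fst e" "snd e"] e(1) by simp
qed

text \<open>The first node of a longest path has a second neighbour, which must lie on the path.\<close>

lemma ex_cycle:
  assumes fin: "finite S" and ne: "S \<noteq> {}"
    and deg: "\<And>v w. (v, w) \<in> adj S \<Longrightarrow> \<exists>w'. w' \<noteq> w \<and> (v, w') \<in> adj S"
  shows "\<exists>xs. is_cycle S xs"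
proof -
  define path where "path xs \<longleftrightarrow> length xs \<ge> 2 \<and> distinct xs \<and> set xs \<subseteq> Field (adj S) \<and>
    successively (\<lambda>x y. (x, y) \<in> adj S) xs" for xs
  have "adj S \<subseteq> (\<lambda>(u, i). (Inl u, Inr i)) ` S \<union> (\<lambda>(u, i). (Inr i, Inl u)) ` S"
    by (force simp: adj_def)
  then have "finite (Field (adj S))"
    using fin by (meson finite_Field finite_UnI finite_imageI finite_subset)
  then have bound: "length xs \<le> card (Field (adj S))" if "path xs" for xs
    using that card_mono[OF \<open>finite (Field (adj S))\<close>] by (metis path_def distinct_card)
  obtain u i where ui: "(u, i) \<in> S" using ne by auto
  then have "(Inl u, Inr i) \<in> adj S" by simp
  then have "path [Inl u, Inr i]"
    by (simp add: path_def FieldI1[OF \<open>(Inl u, Inr i) \<in> adj S\<close>] FieldI2[OF \<open>(Inl u, Inr i) \<in> adj S\<close>])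
  then obtain xs where xs: "path xs" and longest: "\<And>ys. path ys \<Longrightarrow> length ys \<le> length xs"
    using ex_has_greatest_nat[of path _ length "Suc (card (Field (adj S)))"] bound
    by (metis less_Suc_eq_le)
  then obtain x y zs where xyz: "xs = x # y # zs"
    unfolding path_def by (cases xs rule: remdups_adj.cases) auto
  then have "(x, y) \<in> adj S" using xs by (simp add: path_def)
  then obtain w where w: "w \<noteq> y" "(x, w) \<in> adj S" using deg by blast
  have "w \<in> set xs"
  proof (rule ccontr)
    assume "w \<notin> set xs"
    then have "path (w # xs)"
      using xs w adj_sym[OF w(2)] xyz by (auto simp: path_def Field_def)
    then show False using longest by fastforce
  qed
  then obtain j where j: "j < length xs" "xs ! j = w" by (auto simp: in_set_conv_nth)
  \<comment> \<open>\<open>w\<close> is neither \<open>x\<close> nor \<open>y\<close>, so the prefix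
    of \<open>xs\<close> ending in \<open>w\<close> has the three nodes that a cycle
    requires.\<close>
  have "j \<noteq> 0" using j w xyz adj_irrefl by (metis nth_Cons_0)
  moreover have "j \<noteq> 1" using j w xyz by auto
  ultimately have j2: "j \<ge> 2" by simp
  have "(xs ! p, xs ! (Suc p mod Suc j)) \<in> adj S" if "p < Suc j" for p
  proof (cases "p = j")
    case True
    then show ?thesis using j w adj_sym xyz by auto
  next
    case False
    then show ?thesis
      using that j xs by (auto simp: path_def successively_conv_nth)
  qed
  then have "is_cycle S (take (Suc j) xs)"
    using j j2 xs by (simp add: is_cycle_def path_def min_absorb2)
  then show ?thesis by blast
qed

section \<open>Spanning trees as bases of the incidence columns\<close>

locale bipartite_graph =
  fixes U :: "'u set" and I :: "'i set" and E :: "('u \<times> 'i) set"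
  assumes finite_U: "finite U" and finite_I: "finite I" and E_sub: "E \<subseteq> U \<times> I"
begin

sublocale vector_family "nodes U I" E incidence_entry
  using finite_subset[OF E_sub] finite_U finite_I by unfold_locales simp

lemma Inl_in_nodes [simp]: "Inl u \<in> nodes U I \<longleftrightarrow> u \<in> U"
  and Inr_in_nodes [simp]: "Inr i \<in> nodes U I \<longleftrightarrow> i \<in> I"
  by (auto simp: nodes_def)

lemma finite_nodes: "finite (nodes U I)"
  by (simp add: nodes_def finite_U finite_I)

text \<open>A unit flow along a walk: each step adds \<open>1\<close> or \<open>-1\<close> on its
  edge and the boundaries telescope. This is the source of the integrality of coordinates.\<close>

lemma path_flow:
  assumes "(x, y) \<in> (adj T)\<^sup>*" "T \<subseteq> E"
  shows "\<exists>g. supported T g \<and> range g \<subseteq> \<int> \<and> (\<forall>v. comb g v = of_bool (v = x) - of_bool (v = y))"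
  using assms(1)
proof induction
  case base
  show ?case
    by (rule exI[of _ "\<lambda>_. 0"]) (auto simp: supported_def comb_def)
next
  case (step y z)
  then obtain g where g: "supported T g" "range g \<subseteq> \<int>"
    "\<And>v. comb g v = of_bool (v = x) - of_bool (v = y)" by blast
  \<comment> \<open>The sign \<open>s\<close> is \<open>1\<close> when the step goes from user to
    item, the orientation of the column, and \<open>-1\<close> otherwise.\<close>
  obtain u i s where ui: "(u, i) \<in> T" and s: "s \<in> {1, -1 :: real}"
    and yz: "\<And>v. s * incidence_entry v (u, i) = of_bool (v = y) - of_bool (v = z)"
    using step(2)
  proof (cases rule: adjE)
    case (1 u i)
    then show thesis using that[of u i 1] by (simp add: incidence_entry_pair)
  next
    case (2 u i)
    then show thesis using that[of u i "-1"] by (simp add: incidence_entry_pair)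
  qed
  define h where "h = (\<lambda>e. g e + s * of_bool (e = (u, i)))"
  have "(u, i) \<in> E" using ui assms(2) by auto
  then have "comb h v = of_bool (v = x) - of_bool (v = z)" for v
    by (simp add: h_def comb_simps g yz)
  moreover have "supported T h" using g(1) ui by (auto simp: h_def supported_def)
  moreover have "range h \<subseteq> \<int>" using g(2) s by (auto simp: h_def)
  ultimately show ?case by blast
qed

lemma edge_flow:
  assumes "(Inl u, Inr i) \<in> (adj T)\<^sup>*" "T \<subseteq> E"
  obtains g where "supported T g" "range g \<subseteq> \<int>" "\<And>v. comb g v = incidence_entry v (u, i)"
  using path_flow[OF assms] by (auto simp: incidence_entry_pair)

text \<open>The flow round the rest of a cycle reproduces the column of the avoided edge. The
  difference is a relation with coefficient \<open>1\<close> at that edge.\<close>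

lemma indep_imp_acyclic:
  assumes "indep T" "T \<subseteq> E"
  shows "\<nexists>xs. is_cycle T xs"
proof
  assume "\<exists>xs. is_cycle T xs"
  then obtain u i where ui: "(u, i) \<in> T" "(Inl u, Inr i) \<in> (adj (T - {(u, i)}))\<^sup>*"
    using cycle_edge_avoidable by metis
  have "T - {(u, i)} \<subseteq> E" using assms(2) by blast
  from edge_flow[OF ui(2) this]
  obtain g where g: "supported (T - {(u, i)}) g" "\<And>v. comb g v = incidence_entry v (u, i)"
    by metis
  define h where "h = (\<lambda>e. of_bool (e = (u, i)) - g e)"
  have "(u, i) \<in> E" using ui assms by auto
  then have "comb h v = 0" for v by (simp add: h_def comb_simps g)
  moreover have "supported T h" using g(1) ui(1) by (auto simp: h_def supported_def)
  ultimately have "h (u, i) = 0" using assms(1) by (auto simp: indep_def)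
  then show False using g(1) by (simp add: h_def supported_def)
qed

text \<open>In the support \<open>S\<close> of a nontrivial relation no node has degree one, since
  its row would reduce to a single nonzero term; \<open>ex_cycle\<close> then yields a
  cycle.\<close>

lemma acyclic_imp_indep:
  assumes acyc: "\<nexists>xs. is_cycle T xs" and T: "T \<subseteq> E"
  shows "indep T"
  unfolding indep_def
proof (intro allI impI, rule ccontr)
  fix x e
  assume supp: "supported T x" and rel: "\<forall>v\<in>nodes U I. comb x v = 0" and "x e \<noteq> 0"
  define S where "S = {e. x e \<noteq> 0}"
  have ST: "S \<subseteq> T" using supp by (auto simp: S_def supported_def)
  have deg: "\<exists>w'. w' \<noteq> w \<and> (v, w') \<in> adj S" if vw: "(v, w) \<in> adj S" for v w
  proof (rule ccontr)
    assume only: "\<not> ?thesis"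
    obtain u i where ui: "(u, i) \<in> S" "v = Inl u \<and> w = Inr i \<or> v = Inr i \<and> w = Inl u"
      using vw by (auto elim: adjE)
    have uiE: "(u, i) \<in> E" using ui ST T by auto
    have "incidence_entry v f * x f = 0" if "f \<noteq> (u, i)" for f
      using only ui(2) that
      by (cases f) (auto simp: incidence_entry_pair S_def)
    then have "comb x v = (\<Sum>f\<in>{(u, i)}. incidence_entry v f * x f)"
      unfolding comb_def using uiE finite_E by (intro sum.mono_neutral_right) auto
    moreover have "v \<in> nodes U I" using ui(2) uiE E_sub by auto
    ultimately show False
      using rel ui by (auto simp: incidence_entry_pair S_def)
  qed
  have "finite S" using ST T finite_E finite_subset by metis
  moreover have "S \<noteq> {}" using \<open>x e \<noteq> 0\<close> unfolding S_def by blast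
  ultimately have "\<exists>xs. is_cycle S xs" using deg by (rule ex_cycle)
  then show False using acyc is_cycle_mono[OF _ ST] by blast
qed

lemma connected_imp_spans:
  assumes "connected_on U I T" "T \<subseteq> E"
  shows "spans T"
  unfolding spans_def
proof
  fix e assume "e \<in> E"
  obtain u i where ui: "e = (u, i)" by (cases e)
  then have "Inl u \<in> nodes U I" "Inr i \<in> nodes U I"
    using \<open>e \<in> E\<close> E_sub by auto
  then have "(Inl u, Inr i) \<in> (adj T)\<^sup>*"
    using assms(1) by (simp add: connected_on_def)
  from edge_flow[OF this assms(2)]
  show "\<exists>x. supported T x \<and> (\<forall>v\<in>nodes U I. comb x v = incidence_entry v e)"
    using ui by metis
qed

text \<open>Summing the rows of a connected component of \<open>T\<close> annihilates all columns in the span of \<open>T\<close>.\<close>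

lemma spans_imp_connected:
  assumes T: "spans T" "T \<subseteq> E" and E: "connected_on U I E"
  shows "connected_on U I T"
  unfolding connected_on_def
proof (intro conjI ballI)
  show "nodes U I \<noteq> {}" using E by (simp add: connected_on_def)
  fix x y assume x: "x \<in> nodes U I" and y: "y \<in> nodes U I"
  define C where "C = {z \<in> nodes U I. (x, z) \<in> (adj T)\<^sup>*}"
  have finC: "finite C" using finite_nodes by (simp add: C_def)
  have col: "(\<Sum>v\<in>C. incidence_entry v (u, i)) = of_bool (Inl u \<in> C) - of_bool (Inr i \<in> C)" for u i
    using finC by (simp add: incidence_entry_pair sum_subtractf)
  have colT: "(\<Sum>v\<in>C. incidence_entry v f) = 0" if "f \<in> T" for f
  proof -
    obtain u i where f: "f = (u, i)" by (cases f)
    have ui: "(Inl u, Inr i) \<in> adj T" "(Inr i, Inl u) \<in> adj T" "u \<in> U" "i \<in> I"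
      using f that T(2) E_sub by auto
    have "(x, Inl u) \<in> (adj T)\<^sup>* \<longleftrightarrow> (x, Inr i) \<in> (adj T)\<^sup>*"
      using rtrancl_into_rtrancl[OF _ ui(1), of x] rtrancl_into_rtrancl[OF _ ui(2), of x] by blast
    then have "Inl u \<in> C \<longleftrightarrow> Inr i \<in> C"
      using ui by (simp add: C_def)
    then show ?thesis using col f by simp
  qed
  have colE: "(\<Sum>v\<in>C. incidence_entry v e) = 0" if e: "e \<in> E" for e
  proof -
    obtain g where g: "supported T g" "\<And>v. v \<in> nodes U I \<Longrightarrow> comb g v = incidence_entry v e"
      using T(1) e unfolding spans_def by blast
    have "(\<Sum>v\<in>C. incidence_entry v e) = (\<Sum>v\<in>C. comb g v)"
      using g(2) by (intro sum.cong) (auto simp: C_def)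
    also have "\<dots> = (\<Sum>f\<in>E. (\<Sum>v\<in>C. incidence_entry v f) * g f)"
      unfolding comb_def by (subst sum.swap) (simp add: sum_distrib_right)
    also have "\<dots> = 0"
      using colT g(1) by (intro sum.neutral) (auto simp: supported_def)
    finally show ?thesis .
  qed
  \<comment> \<open>A zero column sum over \<open>C\<close> means that the edge has both ends in
    \<open>C\<close> or neither.\<close>
  have closed: "b \<in> C" if "(a, b) \<in> adj E" "a \<in> C" for a b
    using that(1)
  proof (cases rule: adjE)
    case (1 u i)
    then show ?thesis using colE[of "(u, i)"] col[of u i] that by (auto split: if_splits)
  next
    case (2 u i)
    then show ?thesis using colE[of "(u, i)"] col[of u i] that by (auto split: if_splits)
  qed
  have "(x, y) \<in> (adj E)\<^sup>*" using E x y by (auto simp: connected_on_def)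
  then have "y \<in> C"
    by induction (use x closed in \<open>auto simp: C_def\<close>)
  then show "(x, y) \<in> (adj T)\<^sup>*" by (simp add: C_def)
qed

lemma connected_on_mono:
  assumes "connected_on U I T" "T \<subseteq> E"
  shows "connected_on U I E"
  using assms rtrancl_mono[OF adj_mono[OF assms(2)]] unfolding connected_on_def by blast

text \<open>Acyclic corresponds to independent and connected to spanning; connectedness of the whole
  graph enters in passing from spanning to connected.\<close>

lemma spanning_tree_iff_basis:
  assumes "connected_on U I E"
  shows "T \<in> spanning_trees U I E \<longleftrightarrow> basis T"
  unfolding spanning_trees_def basis_def mem_Collect_eq
  using assms indep_imp_acyclic acyclic_imp_indep connected_imp_spans spans_imp_connected by meson

end

locale connected_bipartite_graph = bipartite_graph +
  assumes ex_spanning_tree: "spanning_trees U I E \<noteq> {}"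
begin

lemma connected: "connected_on U I E"
  using ex_spanning_tree connected_on_mono by (auto simp: spanning_trees_def)

text \<open>By uniqueness, the coordinates of an edge in a spanning tree are the integral flow along
  a tree path between its ends.\<close>

sublocale integral_vector_family "nodes U I" E incidence_entry
proof
  show "\<exists>T. basis T"
    using ex_spanning_tree spanning_tree_iff_basis[OF connected] by blast
  fix T e f assume T: "basis T" and e: "e \<in> E"
  obtain u i where ui: "e = (u, i)" by (cases e)
  have "T \<in> spanning_trees U I E"
    using T spanning_tree_iff_basis[OF connected] by blast
  then have "(Inl u, Inr i) \<in> (adj T)\<^sup>*" "T \<subseteq> E"
    using ui e E_sub by (auto simp: spanning_trees_def connected_on_def)
  then obtain g where g: "supported T g" "range g \<subseteq> \<int>" "\<And>v. comb g v = incidence_entry v e"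
    using edge_flow ui by metis
  then have "coord T e = g" by (intro coord_eqI[OF T e])
  then show "coord T e f \<in> \<int>" using g(2) by auto
qed

lemma spanning_centrality_eq_avg_coord:
  assumes "e \<in> E"
  shows "spanning_centrality U I E e = avg_coord e e"
proof -
  have "spanning_trees U I E = {T. basis T}"
    using spanning_tree_iff_basis[OF connected] by blast
  then show ?thesis
    using avg_coord_diag[OF assms] by (simp add: spanning_centrality_def)
qed

end

section \<open>Orthonormal columns and the projector given by the compact SVD\<close>

text \<open>Bessel's inequality: the diagonal entries of \<open>\<Phi> \<Phi>\<^sup>T\<close> are at most \<open>1\<close>, and its trace is \<open>r\<close>.\<close>

lemma orthonormal_cols_le_dim:
  fixes \<Phi> :: "real mat"
  assumes Phi: "\<Phi> \<in> carrier_mat n r" and orth: "transpose_mat \<Phi> * \<Phi> = 1\<^sub>m r"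
  shows "r \<le> n"
proof -
  define Q where "Q = \<Phi> * transpose_mat \<Phi>"
  have Q: "Q \<in> carrier_mat n n" using Phi by (simp add: Q_def)
  have PT: "transpose_mat \<Phi> \<in> carrier_mat r n" using Phi by simp
  have "Q * Q = \<Phi> * (transpose_mat \<Phi> * (\<Phi> * transpose_mat \<Phi>))"
    unfolding Q_def using Phi PT by (intro assoc_mult_mat) auto
  also have "transpose_mat \<Phi> * (\<Phi> * transpose_mat \<Phi>) = transpose_mat \<Phi>"
    using assoc_mult_mat[OF PT Phi PT] orth PT by simp
  finally have QQ: "Q * Q = Q" by (simp add: Q_def)
  have Qij: "Q $$ (i, j) = (\<Sum>l<r. \<Phi> $$ (i, l) * \<Phi> $$ (j, l))" if "i < n" "j < n" for i j
    using that Phi by (simp add: Q_def scalar_prod_def lessThan_atLeast0)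
  have "Q $$ (i, i) \<le> 1" if i: "i < n" for i
  proof -
    have "Q $$ (i, i) = (Q * Q) $$ (i, i)" by (simp add: QQ)
    also have "\<dots> = (\<Sum>j<n. Q $$ (i, j) * Q $$ (j, i))"
      using i Q by (simp add: scalar_prod_def lessThan_atLeast0)
    also have "\<dots> = (\<Sum>j<n. (Q $$ (i, j))\<^sup>2)"
      using i by (intro sum.cong) (auto simp: Qij power2_eq_square mult.commute)
    \<comment> \<open>Keeping only the term \<open>j = i\<close> of the sum of squares bounds the
      square of the diagonal entry by the entry itself.\<close>
    finally have "(Q $$ (i, i))\<^sup>2 \<le> Q $$ (i, i)"
      using i member_le_sum[of i "{..<n}" "\<lambda>j. (Q $$ (i, j))\<^sup>2"] by simp
    then have "Q $$ (i, i) * (Q $$ (i, i) - 1) \<le> 0" by (simp add: power2_eq_square algebra_simps)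
    then show ?thesis by (smt (verit) mult_pos_pos)
  qed
  then have "(\<Sum>i<n. Q $$ (i, i)) \<le> (\<Sum>i<n. 1)" by (intro sum_mono) auto
  moreover have "(\<Sum>i<n. Q $$ (i, i)) = (\<Sum>l<r. \<Sum>i<n. \<Phi> $$ (i, l) * \<Phi> $$ (i, l))"
    by (subst sum.swap) (simp add: Qij)
  moreover have "(\<Sum>i<n. \<Phi> $$ (i, l) * \<Phi> $$ (i, l)) = 1" if "l < r" for l
  proof -
    have "(transpose_mat \<Phi> * \<Phi>) $$ (l, l) = 1" using that by (simp add: orth)
    then show ?thesis using that Phi by (simp add: scalar_prod_def lessThan_atLeast0)
  qed
  ultimately show ?thesis by simp
qed

text \<open>The Gram matrix of the rows is \<open>\<Psi> \<Psi>\<^sup>T\<close>. Orthonormal columns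
  of \<open>\<Psi>\<close> give \<open>B P = B\<close>. If \<open>B c = 0\<close>, multiplying by
  \<open>\<Phi>\<^sup>T\<close> leaves \<open>\<Lambda> \<Psi>\<^sup>T c = 0\<close>, and the
  positive diagonal of \<open>\<Lambda>\<close> forces \<open>\<Psi>\<^sup>T c = 0\<close>.\<close>

lemma row_space_projector_compact_svd:
  assumes svd: "compact_svd B r \<Phi> \<Lambda> \<Psi>"
  shows "row_space_projector {..<dim_row B} {..<dim_col B} (\<lambda>i j. B $$ (i, j))
           (\<lambda>p q. row \<Psi> p \<bullet> row \<Psi> q)"
proof -
  let ?n = "dim_row B" and ?m = "dim_col B"
  have Phi: "\<Phi> \<in> carrier_mat ?n r" and Lam: "\<Lambda> \<in> carrier_mat r r" and Psi: "\<Psi> \<in> carrier_mat ?m r"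
    and diag: "diagonal_mat \<Lambda>" and pos: "\<And>j. j < r \<Longrightarrow> 0 < \<Lambda> $$ (j, j)"
    and PhiPhi: "transpose_mat \<Phi> * \<Phi> = 1\<^sub>m r" and PsiPsi: "transpose_mat \<Psi> * \<Psi> = 1\<^sub>m r"
    and B: "B = \<Phi> * \<Lambda> * transpose_mat \<Psi>"
    using svd unfolding compact_svd_def by blast+
  have PhiT: "transpose_mat \<Phi> \<in> carrier_mat r ?n" and PsiT: "transpose_mat \<Psi> \<in> carrier_mat r ?m"
    and PL: "\<Phi> * \<Lambda> \<in> carrier_mat ?n r" and LP: "\<Lambda> * transpose_mat \<Psi> \<in> carrier_mat r ?m"
    using Phi Psi Lam by auto
  have Bc: "B \<in> carrier_mat ?n ?m" by simp
  define P where "P = \<Psi> * transpose_mat \<Psi>"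
  have P: "P \<in> carrier_mat ?m ?m" using Psi by (simp add: P_def)
  have Ppq: "P $$ (p, q) = row \<Psi> p \<bullet> row \<Psi> q" if "p < ?m" "q < ?m" for p q
    using that Psi by (simp add: P_def)
  have "B * P = \<Phi> * \<Lambda> * (transpose_mat \<Psi> * P)"
    using assoc_mult_mat[OF PL PsiT P] B by metis
  also have "transpose_mat \<Psi> * P = transpose_mat \<Psi>"
    unfolding P_def using assoc_mult_mat[OF PsiT Psi PsiT] PsiPsi PsiT by simp
  finally have BP: "B * P = B" using B by metis
  have "transpose_mat \<Phi> * B = transpose_mat \<Phi> * (\<Phi> * (\<Lambda> * transpose_mat \<Psi>))"
    using assoc_mult_mat[OF Phi Lam PsiT] B by metis
  also have "\<dots> = \<Lambda> * transpose_mat \<Psi>"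
    using assoc_mult_mat[OF PhiT Phi LP] left_mult_one_mat[OF LP] unfolding PhiPhi by simp
  finally have PhiB: "transpose_mat \<Phi> * B = \<Lambda> * transpose_mat \<Psi>" .
  have kernel: "P *\<^sub>v c = 0\<^sub>v ?m" if c: "c \<in> carrier_vec ?m" and Bc0: "B *\<^sub>v c = 0\<^sub>v ?n" for c
  proof -
    define d where "d = transpose_mat \<Psi> *\<^sub>v c"
    have d: "d \<in> carrier_vec r" using PsiT c by (simp add: d_def)
    have "\<Lambda> *\<^sub>v d = transpose_mat \<Phi> *\<^sub>v (B *\<^sub>v c)"
      unfolding d_def using assoc_mult_mat_vec[OF Lam PsiT c] assoc_mult_mat_vec[OF PhiT Bc c] PhiB
      by simp
    also have "\<dots> = 0\<^sub>v r" using PhiT Bc0 by auto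
    finally have Ld: "\<Lambda> *\<^sub>v d = 0\<^sub>v r" .
    have "d $ j = 0" if j: "j < r" for j
    proof -
      have "0 = (\<Lambda> *\<^sub>v d) $ j" using Ld j by simp
      also have "\<dots> = (\<Sum>l\<in>{0..<r}. \<Lambda> $$ (j, l) * d $ l)"
        using j Lam d by (simp add: scalar_prod_def)
      also have "\<dots> = (\<Sum>l\<in>{j}. \<Lambda> $$ (j, l) * d $ l)"
        using j diag Lam by (intro sum.mono_neutral_right) (auto simp: diagonal_mat_def)
      finally show ?thesis using pos[OF j] by simp
    qed
    then have "d = 0\<^sub>v r" using d by auto
    then show ?thesis
      using assoc_mult_mat_vec[OF Psi PsiT c] Psi by (auto simp: P_def d_def)
  qed
  show ?thesis
    unfolding row_space_projector_def
  proof (intro conjI ballI allI impI)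
    show "row \<Psi> e \<bullet> row \<Psi> f = row \<Psi> f \<bullet> row \<Psi> e" for e f
      using Psi by (intro comm_scalar_prod[of _ r]) auto
    show "(\<Sum>f<?m. B $$ (v, f) * (row \<Psi> f \<bullet> row \<Psi> e)) = B $$ (v, e)"
      if "v \<in> {..<?n}" "e \<in> {..<?m}" for v e
    proof -
      have "B $$ (v, e) = (B * P) $$ (v, e)" by (simp add: BP)
      also have "\<dots> = (\<Sum>f<?m. B $$ (v, f) * P $$ (f, e))"
        using that P by (simp add: scalar_prod_def lessThan_atLeast0)
      finally show ?thesis using that by (simp add: Ppq)
    qed
    show "(\<Sum>e<?m. (row \<Psi> f \<bullet> row \<Psi> e) * c e) = 0"
      if c: "\<forall>v\<in>{..<?n}. (\<Sum>e<?m. B $$ (v, e) * c e) = 0" and f: "f \<in> {..<?m}" for c f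
    proof -
      have "B *\<^sub>v vec ?m c = 0\<^sub>v ?n"
        using c by (intro eq_vecI) (auto simp: scalar_prod_def lessThan_atLeast0)
      then have "(P *\<^sub>v vec ?m c) $ f = 0" using kernel f by simp
      then have "(\<Sum>e<?m. P $$ (f, e) * c e) = 0"
        using f P by (simp add: scalar_prod_def lessThan_atLeast0)
      then show ?thesis using f by (simp add: Ppq)
    qed
  qed
qed

text \<open>Zero columns do not change row norms, and \<open>r \<le> k\<close> ensures that no
  column of \<open>\<Psi>'\<close> is cut off.\<close>

lemma l2_norm_row_top_k_svd:
  assumes Psi: "\<Psi> \<in> carrier_mat m k" and Psi': "\<Psi>' \<in> carrier_mat m r" and "r \<le> k" and q: "q < m"
    and cols: "\<And>j. j < k \<Longrightarrow> col \<Psi> j = (if j < r then col \<Psi>' j else 0\<^sub>v m)"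
  shows "(l2_norm_vec (row \<Psi> q))\<^sup>2 = row \<Psi>' q \<bullet> row \<Psi>' q"
proof -
  have ent: "\<Psi> $$ (q, j) = (if j < r then \<Psi>' $$ (q, j) else 0)" if "j < k" for j
  proof -
    have "\<Psi> $$ (q, j) = col \<Psi> j $ q" using Psi q that by simp
    then show ?thesis using cols[OF that] Psi' q that by simp
  qed
  have "(l2_norm_vec (row \<Psi> q))\<^sup>2 = (\<Sum>j<k. (\<Psi> $$ (q, j))\<^sup>2)"
    using Psi q by (simp add: l2_norm_vec_def L2_set_def sum_nonneg)
  also have "\<dots> = (\<Sum>j<r. (\<Psi>' $$ (q, j))\<^sup>2)"
    using \<open>r \<le> k\<close> by (intro sum.mono_neutral_cong_right) (auto simp: ent)
  also have "\<dots> = row \<Psi>' q \<bullet> row \<Psi>' q"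
    using Psi' q by (simp add: scalar_prod_def lessThan_atLeast0 power2_eq_square)
  finally show ?thesis .
qed

section \<open>Spanning centralities as squared row norms\<close>

theorem theorem4p4:
  fixes U :: "'u set" and I :: "'i set" and E :: "('u \<times> 'i) set"
    and vs :: "('u + 'i) list" and es :: "('u \<times> 'i) list"
    and k :: nat and \<Phi> \<Lambda> \<Psi> :: "real mat"
  assumes "finite U" and "finite I" and "E \<subseteq> U \<times> I"
    and "distinct vs" and "set vs = nodes U I"
    and "distinct es" and "set es = E"
    and "spanning_trees U I E \<noteq> {}"
    and "top_k_svd (incidence_matrix vs es) k \<Phi> \<Lambda> \<Psi>"
    and "k = card U + card I"
  shows "\<forall>q < length es. spanning_centrality U I E (es ! q) = (l2_norm_vec (row \<Psi> q))\<^sup>2"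
proof (intro allI impI)
  fix q assume q: "q < length es"
  let ?B = "incidence_matrix vs es"
  let ?V = "{..<length vs}" and ?Q = "{..<length es}"
  interpret connected_bipartite_graph U I E
    using assms by unfold_locales
  have dims: "dim_row ?B = length vs" "dim_col ?B = length es"
    by (simp_all add: incidence_matrix_def)
  obtain r \<Phi>' \<Lambda>' \<Psi>' where svd: "compact_svd ?B r \<Phi>' \<Lambda>' \<Psi>'"
    and cols: "\<And>j. j < k \<Longrightarrow> col \<Psi> j = (if j < r then col \<Psi>' j else 0\<^sub>v (length es))"
    and Psi: "\<Psi> \<in> carrier_mat (length es) k"
    using assms(9) unfolding top_k_svd_def dims by metis
  \<comment> \<open>The choice of \<open>k\<close> enters here: \<open>B\<close> has
    \<open>k\<close> rows, so at most \<open>k\<close> orthonormal left singular vectors exist and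
    the truncation drops no positive singular value.\<close>
  have "length vs = card (nodes U I)"
    using assms(4,5) distinct_card by metis
  also have "\<dots> = k"
    unfolding nodes_def using assms(1,2,10)
    by (subst card_Un_disjoint) (auto simp: card_image)
  finally have "r \<le> k"
    using orthonormal_cols_le_dim[of \<Phi>' k r] svd by (auto simp: compact_svd_def dims)
  then have norm: "(l2_norm_vec (row \<Psi> q))\<^sup>2 = row \<Psi>' q \<bullet> row \<Psi>' q"
    using l2_norm_row_top_k_svd[OF Psi _ _ q cols] svd by (simp add: compact_svd_def dims)
  \<comment> \<open>Both the averaged coordinates and the Gram matrix of the rows of
    \<open>\<Psi>'\<close> are projectors for the same numbered matrix, so their diagonals
    agree.\<close>
  have "row_space_projector ?V ?Q (\<lambda>p q. incidence_entry (vs ! p) (es ! q))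
      (\<lambda>p q. avg_coord (es ! p) (es ! q))"
    by (rule row_space_projector_reindex[OF row_space_projector_avg_coord])
      (use assms(4-7) in \<open>auto intro: bij_betw_nth\<close>)
  moreover have "row_space_projector ?V ?Q (\<lambda>p q. incidence_entry (vs ! p) (es ! q))
      (\<lambda>p q. row \<Psi>' p \<bullet> row \<Psi>' q)"
    using row_space_projector_compact_svd[OF svd] unfolding dims
    by (rule row_space_projector_cong[THEN iffD1, rotated]) (simp add: incidence_matrix_def)
  ultimately have "avg_coord (es ! q) (es ! q) = row \<Psi>' q \<bullet> row \<Psi>' q"
    using row_space_projector_unique[of ?Q] q by blast
  then show "spanning_centrality U I E (es ! q) = (l2_norm_vec (row \<Psi> q))\<^sup>2"
    using norm q assms(7) nth_mem[OF q] by (simp add: spanning_centrality_eq_avg_coord)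
qed

end
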